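(* Let $(n_j)_{j\ge0}$ be a sequence of indices with $n_j\to\infty$ such that, for all $i\in\Gamma$ and $(t,x)\in[0,T]\times\mathbb{R}^d$, $u^{i,n_j}(t,x)$ converges as $j\to\infty$ to a real limit, the limit being measurable in $(t,x)$, and such that for some $C>0$, $\rho\ge1$ one has $|u^{i,n_j}(t,x)|\le C(1+|x|^\rho)$ for all $i\in\Gamma$, $j\ge0$ and $(t,x)\in[0,T]\times\mathbb{R}^d$. For each $(t,x)\in[0,T]\times\mathbb{R}^d$ let $(Y^{i;t,x},Z^{i;t,x},K^{i;t,x})_{i\in\Gamma}$ be the solution of the reflected system (defined in the context) which is the limit of the penalized solutions along $(n_j)$, i.e. such that for all $i\in\Gamma$ $$\lim_{j\to\infty}\mathsf{E}\Big[\sup_{t\le s\le T}|Y^{i,n_j;t,x}_s-Y^{i;t,x}_s|^2+\int_t^T|Z^{i,n_j;t,x}_s-Z^{i;t,x}_s|^2ds+\sup_{t\le s\le T}|K^{i,n_j;t,x}_s-K^{i;t,x}_s|^2\Big]=0.$$ Then there exist measurable deterministic functions $(u^i)_{i\in\Gamma}$ and $(v^i)_{i\in\Gamma}$, with $u^i:[0,T]\times\mathbb{R}^d\to\mathbb{R}$ and $v^i:[0,T]\times\mathbb{R}^d\to\mathbb{R}^d$, such that for any $(t,x)\in[0,T]\times\mathbb{R}^d$ and $i\in\Gamma$ $$Y^{i;t,x}_s=u^i(s,X^{t,x}_s)\quad\text{and}\quad Z^{i;t,x}_s=v^i(s,X^{t,x}_s),\qquad\mathsf{P}\text{-a.s.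 for a.e. }s\in[t,T].$$
   Context: Setting. Let $T>0$, let $d,m\ge1$ be integers and $\Gamma:=\{1,\dots,m\}$ (if $m=1$, sums over $j\neq i$ are $0$, and the obstacle conditions are void with $K^i=0$). $(\Omega,\mathcal{F},\mathsf{P})$ is a probability space carrying a $d$-dimensional standard Brownian motion $B=(B_t)_{t\in[0,T]}$; $(\mathcal{F}_t)_{t\le T}$ is the filtration generated by $B$, completed with the $\mathsf{P}$-null sets of $\mathcal{F}$. $|\cdot|$ denotes Euclidean norms. For $Z^i=(Z^{i1},\dots,Z^{id})$ one writes $Z^i\,dB:=\sum_{l=1}^d Z^{il}dB^l$; $a^-:=\max(-a,0)$. Spaces. $\mathbf{H}^2_T(\mathbb{R}^d)$: $\mathbb{R}^d$-valued progressively measurable $\zeta$ with $\mathsf{E}[\int|\zeta_s|^2ds]<\infty$. $\mathbf{S}^2_T(\mathbb{R})$: real-valued, progressively measurable, continuous $\xi$ with $\mathsf{E}[\sup_s|\xi_s|^2]<\infty$. $\mathbf{A}^2_T$: non-decreasing processes in $\mathbf{S}^2_T(\mathbb{R})$ which are null at the initial time. For a system started at time $t$, processes are considered on $[t,T]$ and the initial time is $t$. Forward process. For $(t,x)\in[0,T]\times\mathbb{R}^d$, $X^{t,x}$ is the unique solution of $X^{t,x}_s=x+\int_t^s b(r,X^{t,x}_r)dr+\int_t^s\sigma(r,X^{t,x}_r)dB_r$, $s\in[t,T]$, where $b:[0,T]\times\mathbb{R}^d\to\mathbb{R}^d$ and $\sigma:[0,T]\times\mathbb{R}^d\to\mathbb{R}^{d\times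 d}$ are jointly continuous, Lipschitz in $x$ uniformly in $t$, and for some $\theta>0$: $\theta^{-1}|\zeta|^2\le\langle\sigma(t,x)\sigma(t,x)^\top\zeta,\zeta\rangle\le\theta|\zeta|^2$ for all $(t,x)$ and $\zeta\in\mathbb{R}^d$. Writing $\mu(t,x;s,dy)$ for the law of $X^{t,x}_s$, the process satisfies (as a consequence of these conditions) the $L^2$-domination condition: there is $x_0\in\mathbb{R}^d$ such that for all $(t,x)$ and $\delta>0$ with $t+\delta\le T$ there is $\phi^{\delta}_{t,x,x_0}:[t,T]\times\mathbb{R}^d\to\mathbb{R}_+$ with $\mu(t,x;s,dy)ds=\phi^\delta_{t,x,x_0}(s,y)\mu(0,x_0;s,dy)ds$ on $[t+\delta,T]\times\mathbb{R}^d$ and $\phi^\delta_{t,x,x_0}\in L^2([t+\delta,T]\times[-N,N]^d;\mu(0,x_0;s,dy)ds)$ for every $N\ge1$. The generator is $\mathbb{L}_X\psi=\frac12\sum_{k,l}(\sigma\sigma^\top)_{kl}\partial^2_{x_kx_l}\psi+\sum_k b_k\partial_{x_k}\psi$. Data (deterministic, Borel measurable), for all $i,j\in\Gamma$: - $f_i:[0,T]\times\mathbb{R}^{d}\times\mathbb{R}^m\times\mathbb{R}^{m\times d}\to\mathbb{R}$, $f_i(t,x,\vec y,\vec z)$, is Lipschitz in $(\vec y,\vec z)$ uniformly in $(t,x)$, and there are $C>0$, $q\ge1$ with $|f_i(t,x,\vec y,\vec z)|\le C(1+|x|^q)$ for all $(t,x,\vec y,\vec z)$. - $g_{ij}:[0,T]\times\mathbb{R}^d\to\mathbb{R}_+$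 satisfies: $g_{ii}=0$; $g_{ij}(t,x)<g_{i\ell}(t,x)+g_{\ell j}(t,x)$ for all $(t,x)$ whenever $i,j,\ell$ are pairwise distinct; $g_{ij}\in C^{1,2}([0,T]\times\mathbb{R}^d)$ and $\partial_tg_{ij}+\mathbb{L}_Xg_{ij}\le0$ on $[0,T]\times\mathbb{R}^d$. - $h_i:\mathbb{R}^d\to\mathbb{R}$ satisfies $|h_i(x)|\le C(1+|x|^p)$ for some $p\ge0$, and $h_i(x)\ge\max_{j\ne i}(h_j(x)-g_{ij}(T,x))$. Reflected system. For given $(t,x)$, a solution is a family of adapted processes $(Y^i,Z^i,K^i)_{i\in\Gamma}$ with $Y^i\in\mathbf{S}^2_T(\mathbb{R})$, $Z^i\in\mathbf{H}^2_T(\mathbb{R}^d)$, $K^i\in\mathbf{A}^2_T$ and, $\mathsf{P}$-a.s. for all $s\in[t,T]$ and $i\in\Gamma$: $Y^i_s=h_i(X^{t,x}_T)+\int_s^Tf_i(r,X^{t,x}_r,(Y^k_r)_{k},(Z^k_r)_{k})dr+K^i_T-K^i_s-\int_s^TZ^i_rdB_r$; $Y^i_s\ge\max_{j\ne i}\{Y^j_s-g_{ij}(s,X^{t,x}_s)\}$; $\int_t^T(Y^i_s-\max_{j\ne i}\{Y^j_s-g_{ij}(s,X^{t,x}_s)\})dK^i_s=0$. Penalized system. For $n\ge1$ and $(t,x)$, $(Y^{i,n;t,x},Z^{i,n;t,x})_{i\in\Gamma}$ is the unique family in $\mathbf{S}^2_T(\mathbb{R})\times\mathbf{H}^2_T(\mathbb{R}^d)$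 with, for all $s\in[t,T]$, $i\in\Gamma$, $$Y^{i,n;t,x}_s=h_i(X^{t,x}_T)+\int_s^T\Big[f_i\big(r,X^{t,x}_r,(Y^{k,n;t,x}_r)_{k},(Z^{k,n;t,x}_r)_{k}\big)+n\sum_{j\ne i}\big(Y^{i,n;t,x}_r-Y^{j,n;t,x}_r+g_{ij}(r,X^{t,x}_r)\big)^-\Big]dr-\int_s^TZ^{i,n;t,x}_rdB_r.$$ Set $K^{i,n;t,x}_s:=n\sum_{j\ne i}\int_t^s(Y^{i,n;t,x}_r-Y^{j,n;t,x}_r+g_{ij}(r,X^{t,x}_r))^-dr$. By the Markov property there are measurable deterministic functions $u^{i,n}:[0,T]\times\mathbb{R}^d\to\mathbb{R}$ and $v^{i,n}:[0,T]\times\mathbb{R}^d\to\mathbb{R}^d$, not depending on $(t,x)$, with $Y^{i,n;t,x}_s=u^{i,n}(s,X^{t,x}_s)$ and $Z^{i,n;t,x}_s=v^{i,n}(s,X^{t,x}_s)$ for $s\in[t,T]$; in particular $u^{i,n}(t,x)=Y^{i,n;t,x}_t$ for all $(t,x)$. *)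

theory Defs
  imports "HOL-Probability.Probability"
begin

section \<open>Brownian motion, its augmented filtration, spaces of processes\<close>

definition brownian_filtration ::
  "'a measure \<Rightarrow> (real \<Rightarrow> 'a \<Rightarrow> real^'d) \<Rightarrow> real \<Rightarrow> 'a measure" where
  "brownian_filtration M B t =
     sigma (space M)
       ((\<Union>s\<in>{0..t}. {B s -` A \<inter> space M | A. A \<in> sets borel}) \<union> null_sets M)"

definition brownian_motion ::
  "'a measure \<Rightarrow> real \<Rightarrow> (real \<Rightarrow> 'a \<Rightarrow> real^'d) \<Rightarrow> bool" where
  "brownian_motion M T B \<longleftrightarrow>
     (\<forall>s\<in>{0..T}. B s \<in> borel_measurable M) \<and>
     (AE \<omega> in M. B 0 \<omega> = 0) \<and>
     (AE \<omega> in M. continuous_on {0..T} (\<lambda>s. B s \<omega>)) \<and>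
     (\<forall>r s. 0 \<le> r \<and> r < s \<and> s \<le> T \<longrightarrow>
        distributed M lborel (\<lambda>\<omega>. B s \<omega> - B r \<omega>)
          (\<lambda>x. \<Prod>k\<in>UNIV. ennreal (normal_density 0 (sqrt (s - r)) (x $ k))) \<and>
        prob_space.indep_set M (sets (brownian_filtration M B r))
          (sets (vimage_algebra (space M) (\<lambda>\<omega>. B s \<omega> - B r \<omega>) borel)))"

text \<open>A process on \<open>[t,T]\<close> is a function of time and scenario whose values at times
  outside \<open>[t,T]\<close> are irrelevant. Continuity and monotonicity of paths are required for
  every scenario; equations between processes are only required almost surely.\<close>

definition progressive ::
  "(real \<Rightarrow> 'a measure) \<Rightarrow> real \<Rightarrow> real \<Rightarrow> (real \<Rightarrow> 'a \<Rightarrow> 'b::topological_space) \<Rightarrow> bool" where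
  "progressive F t T H \<longleftrightarrow>
     (\<forall>s\<in>{t..T}. (\<lambda>(r, \<omega>). H r \<omega>) \<in> borel_measurable (restrict_space borel {t..s} \<Otimes>\<^sub>M F s))"

definition continuous_paths ::
  "'a measure \<Rightarrow> real \<Rightarrow> real \<Rightarrow> (real \<Rightarrow> 'a \<Rightarrow> 'b::topological_space) \<Rightarrow> bool" where
  "continuous_paths M t T H \<longleftrightarrow> (\<forall>\<omega>\<in>space M. continuous_on {t..T} (\<lambda>s. H s \<omega>))"

definition space_H2 ::
  "'a measure \<Rightarrow> (real \<Rightarrow> 'a measure) \<Rightarrow> real \<Rightarrow> real \<Rightarrow> (real \<Rightarrow> 'a \<Rightarrow> 'b::real_normed_vector) set" where
  "space_H2 M F t T =
     {H. progressive F t T H \<and>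
         (\<integral>\<^sup>+\<omega>. (\<integral>\<^sup>+s\<in>{t..T}. ennreal ((norm (H s \<omega>))\<^sup>2) \<partial>lborel) \<partial>M) < \<infinity>}"

definition space_S2 ::
  "'a measure \<Rightarrow> (real \<Rightarrow> 'a measure) \<Rightarrow> real \<Rightarrow> real \<Rightarrow> (real \<Rightarrow> 'a \<Rightarrow> real) set" where
  "space_S2 M F t T =
     {H. progressive F t T H \<and> continuous_paths M t T H \<and>
         (\<integral>\<^sup>+\<omega>. (SUP s\<in>{t..T}. ennreal (\<bar>H s \<omega>\<bar>\<^sup>2)) \<partial>M) < \<infinity>}"

definition space_A2 ::
  "'a measure \<Rightarrow> (real \<Rightarrow> 'a measure) \<Rightarrow> real \<Rightarrow> real \<Rightarrow> (real \<Rightarrow> 'a \<Rightarrow> real) set" where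
  "space_A2 M F t T =
     {K \<in> space_S2 M F t T. \<forall>\<omega>\<in>space M. mono_on {t..T} (\<lambda>s. K s \<omega>) \<and> K t \<omega> = 0}"


section \<open>The It\^o integral\<close>

text \<open>An elementary integrand on \<open>[t,T]\<close> is \<open>\<Sum>l<k. 1\<^bsub>(p l, p (l+1)]\<^esub> \<xi> l\<close> with \<open>\<xi> l\<close> bounded
  and measurable at time \<open>p l\<close>.\<close>

definition elementary ::
  "'a measure \<Rightarrow> (real \<Rightarrow> 'a measure) \<Rightarrow> real \<Rightarrow> real \<Rightarrow>
     nat \<Rightarrow> (nat \<Rightarrow> real) \<Rightarrow> (nat \<Rightarrow> 'a \<Rightarrow> real^'d) \<Rightarrow> bool" where
  "elementary M F t T k p \<xi> \<longleftrightarrow>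
     (\<forall>l<k. t \<le> p l \<and> p l \<le> p (Suc l) \<and> p (Suc l) \<le> T) \<and>
     (\<forall>l<k. \<xi> l \<in> borel_measurable (F (p l)) \<and> (\<exists>c. \<forall>\<omega>\<in>space M. norm (\<xi> l \<omega>) \<le> c))"

definition elementary_process ::
  "nat \<Rightarrow> (nat \<Rightarrow> real) \<Rightarrow> (nat \<Rightarrow> 'a \<Rightarrow> real^'d) \<Rightarrow> real \<Rightarrow> 'a \<Rightarrow> real^'d" where
  "elementary_process k p \<xi> s \<omega> = (\<Sum>l<k. indicator {p l<..p (Suc l)} s *\<^sub>R \<xi> l \<omega>)"

definition elementary_integral ::
  "(real \<Rightarrow> 'a \<Rightarrow> real^'d) \<Rightarrow> nat \<Rightarrow> (nat \<Rightarrow> real) \<Rightarrow> (nat \<Rightarrow> 'a \<Rightarrow> real^'d) \<Rightarrow> real \<Rightarrow> 'a \<Rightarrow> real" where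
  "elementary_integral B k p \<xi> s \<omega> =
     (\<Sum>l<k. \<xi> l \<omega> \<bullet> (B (min s (p (Suc l))) \<omega> - B (min s (p l)) \<omega>))"

text \<open>\<open>has_ito_integral M F B t T H I\<close>: the continuous adapted process \<open>I\<close> is (a version of)
  \<open>s \<mapsto> \<integral>\<^sub>t\<^sup>s H\<^sub>r dB\<^sub>r\<close> on \<open>[t,T]\<close>, the \<open>L\<^sup>2\<close>-limit of the integrals of elementary
  integrands converging to \<open>H\<close>; by the isometry, \<open>I\<close> is unique up to indistinguishability.\<close>

definition has_ito_integral ::
  "'a measure \<Rightarrow> (real \<Rightarrow> 'a measure) \<Rightarrow> (real \<Rightarrow> 'a \<Rightarrow> real^'d) \<Rightarrow> real \<Rightarrow> real \<Rightarrow>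
     (real \<Rightarrow> 'a \<Rightarrow> real^'d) \<Rightarrow> (real \<Rightarrow> 'a \<Rightarrow> real) \<Rightarrow> bool" where
  "has_ito_integral M F B t T H I \<longleftrightarrow>
     H \<in> space_H2 M F t T \<and> progressive F t T I \<and> continuous_paths M t T I \<and>
     (\<exists>k p \<xi>.
        (\<forall>n. elementary M F t T (k n) (p n) (\<xi> n)) \<and>
        (\<lambda>n. \<integral>\<^sup>+\<omega>. (\<integral>\<^sup>+s\<in>{t..T}.
            ennreal ((norm (elementary_process (k n) (p n) (\<xi> n) s \<omega> - H s \<omega>))\<^sup>2) \<partial>lborel) \<partial>M)
          \<longlonglongrightarrow> 0 \<and>
        (\<forall>s\<in>{t..T}.
          (\<lambda>n. \<integral>\<^sup>+\<omega>. ennreal ((elementary_integral B (k n) (p n) (\<xi> n) s \<omega> - I s \<omega>)\<^sup>2) \<partial>M)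
            \<longlonglongrightarrow> 0))"


section \<open>The forward process\<close>

definition forward_coefficients ::
  "real \<Rightarrow> (real \<Rightarrow> real^'d \<Rightarrow> real^'d) \<Rightarrow> (real \<Rightarrow> real^'d \<Rightarrow> real^'d^'d) \<Rightarrow> bool" where
  "forward_coefficients T b \<sigma> \<longleftrightarrow>
     continuous_on ({0..T} \<times> UNIV) (\<lambda>(t, x). b t x) \<and>
     continuous_on ({0..T} \<times> UNIV) (\<lambda>(t, x). \<sigma> t x) \<and>
     (\<exists>L. \<forall>t\<in>{0..T}. L-lipschitz_on UNIV (b t)) \<and>
     (\<exists>L. \<forall>t\<in>{0..T}. L-lipschitz_on UNIV (\<sigma> t)) \<and>
     (\<exists>\<theta>>0. \<forall>t\<in>{0..T}. \<forall>x \<zeta>.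
        inverse \<theta> * (norm \<zeta>)\<^sup>2 \<le> ((\<sigma> t x ** transpose (\<sigma> t x)) *v \<zeta>) \<bullet> \<zeta> \<and>
        ((\<sigma> t x ** transpose (\<sigma> t x)) *v \<zeta>) \<bullet> \<zeta> \<le> \<theta> * (norm \<zeta>)\<^sup>2)"

text \<open>The stochastic integral of the matrix-valued integrand is taken row by row.\<close>

definition sde_solution ::
  "'a measure \<Rightarrow> (real \<Rightarrow> 'a \<Rightarrow> real^'d) \<Rightarrow> real \<Rightarrow>
     (real \<Rightarrow> real^'d \<Rightarrow> real^'d) \<Rightarrow> (real \<Rightarrow> real^'d \<Rightarrow> real^'d^'d) \<Rightarrow>
     real \<Rightarrow> real^'d \<Rightarrow> (real \<Rightarrow> 'a \<Rightarrow> real^'d) \<Rightarrow> bool" where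
  "sde_solution M B T b \<sigma> t x X \<longleftrightarrow>
     progressive (brownian_filtration M B) t T X \<and> continuous_paths M t T X \<and>
     (\<exists>I. (\<forall>k. has_ito_integral M (brownian_filtration M B) B t T
               (\<lambda>r \<omega>. \<sigma> r (X r \<omega>) $ k) (I k)) \<and>
          (AE \<omega> in M. \<forall>s\<in>{t..T}.
             X s \<omega> = x + (LBINT r:{t..s}. b r (X r \<omega>)) + (\<chi> k. I k s \<omega>)))"

text \<open>The law \<open>\<mu>(t,x;s,dy)\<close> of \<open>X\<^sup>t\<^sup>,\<^sup>x\<^sub>s\<close>. The identity between the measures
  \<open>\<mu>(t,x;s,dy)ds\<close> and \<open>\<phi>(s,y)\<mu>(0,x0;s,dy)ds\<close> on \<open>[t+\<delta>,T] \<times> \<real>\<^sup>d\<close> is expressed on Borel sets.\<close>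

definition forward_law ::
  "'a measure \<Rightarrow> (real \<Rightarrow> real^'d \<Rightarrow> real \<Rightarrow> 'a \<Rightarrow> real^'d) \<Rightarrow>
     real \<Rightarrow> real^'d \<Rightarrow> real \<Rightarrow> (real^'d) measure" where
  "forward_law M X t x s = distr M borel (X t x s)"

definition L2_domination ::
  "'a measure \<Rightarrow> real \<Rightarrow> (real \<Rightarrow> real^'d \<Rightarrow> real \<Rightarrow> 'a \<Rightarrow> real^'d) \<Rightarrow> bool" where
  "L2_domination M T X \<longleftrightarrow>
     (\<exists>x0. \<forall>t\<in>{0..T}. \<forall>x. \<forall>\<delta>>0. t + \<delta> \<le> T \<longrightarrow>
       (\<exists>\<phi> :: real \<Rightarrow> real^'d \<Rightarrow> real.
          (\<lambda>(s, y). \<phi> s y) \<in> borel_measurable (restrict_space borel ({t..T} \<times> UNIV)) \<and>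
          (\<forall>s\<in>{t..T}. \<forall>y. \<phi> s y \<ge> 0) \<and>
          (\<forall>A\<in>sets borel.
             (\<integral>\<^sup>+s\<in>{t+\<delta>..T}. emeasure (forward_law M X t x s) {y. (s, y) \<in> A} \<partial>lborel) =
             (\<integral>\<^sup>+s\<in>{t+\<delta>..T}.
                (\<integral>\<^sup>+y. ennreal (\<phi> s y) * indicator A (s, y) \<partial>forward_law M X 0 x0 s) \<partial>lborel)) \<and>
          (\<forall>N::nat. N \<ge> 1 \<longrightarrow>
             (\<integral>\<^sup>+s\<in>{t+\<delta>..T}.
                (\<integral>\<^sup>+y\<in>{y. \<forall>k. \<bar>y $ k\<bar> \<le> real N}. ennreal ((\<phi> s y)\<^sup>2) \<partial>forward_law M X 0 x0 s)
              \<partial>lborel) < \<infinity>)))"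


section \<open>Data of the switching problem\<close>

text \<open>\<open>\<psi>\<close> is of class \<open>C\<^sup>1\<^sup>,\<^sup>2\<close> on \<open>[0,T] \<times> \<real>\<^sup>d\<close> with time derivative \<open>\<psi>t\<close> (one-sided at \<open>0\<close> and
  \<open>T\<close>), spatial gradient \<open>D\<close> and Hessian \<open>D2\<close>.\<close>

definition C12_with ::
  "real \<Rightarrow> (real \<Rightarrow> real^'d \<Rightarrow> real) \<Rightarrow> (real \<Rightarrow> real^'d \<Rightarrow> real) \<Rightarrow>
     (real \<Rightarrow> real^'d \<Rightarrow> real^'d) \<Rightarrow> (real \<Rightarrow> real^'d \<Rightarrow> real^'d^'d) \<Rightarrow> bool" where
  "C12_with T \<psi> \<psi>t D D2 \<longleftrightarrow>
     continuous_on ({0..T} \<times> UNIV) (\<lambda>(t, x). \<psi> t x) \<and>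
     continuous_on ({0..T} \<times> UNIV) (\<lambda>(t, x). \<psi>t t x) \<and>
     continuous_on ({0..T} \<times> UNIV) (\<lambda>(t, x). D t x) \<and>
     continuous_on ({0..T} \<times> UNIV) (\<lambda>(t, x). D2 t x) \<and>
     (\<forall>t\<in>{0..T}. \<forall>x.
        ((\<lambda>s. \<psi> s x) has_real_derivative \<psi>t t x) (at t within {0..T}) \<and>
        ((\<lambda>y. \<psi> t y) has_derivative (\<lambda>v. D t x \<bullet> v)) (at x) \<and>
        ((\<lambda>y. D t y) has_derivative (\<lambda>v. D2 t x *v v)) (at x))"

text \<open>The generator at \<open>(t,x)\<close>, as a function of the gradient and the Hessian there.\<close>

definition generator ::
  "(real \<Rightarrow> real^'d \<Rightarrow> real^'d) \<Rightarrow> (real \<Rightarrow> real^'d \<Rightarrow> real^'d^'d) \<Rightarrow>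
     real \<Rightarrow> real^'d \<Rightarrow> real^'d \<Rightarrow> real^'d^'d \<Rightarrow> real" where
  "generator b \<sigma> t x D D2 =
     1/2 * (\<Sum>k\<in>UNIV. \<Sum>l\<in>UNIV. (\<sigma> t x ** transpose (\<sigma> t x)) $ k $ l * D2 $ k $ l) +
     (\<Sum>k\<in>UNIV. b t x $ k * D $ k)"

definition driver_data ::
  "real \<Rightarrow> ('m::finite \<Rightarrow> real \<Rightarrow> real^'d \<Rightarrow> real^'m \<Rightarrow> real^'d^'m \<Rightarrow> real) \<Rightarrow> bool" where
  "driver_data T f \<longleftrightarrow>
     (\<forall>i. (\<lambda>(t, x, y, z). f i t x y z) \<in> borel_measurable (restrict_space borel ({0..T} \<times> UNIV))) \<and>
     (\<exists>L. \<forall>i. \<forall>t\<in>{0..T}. \<forall>x. L-lipschitz_on UNIV (\<lambda>(y, z). f i t x y z)) \<and>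
     (\<exists>C>0. \<exists>q\<ge>1. \<forall>i. \<forall>t\<in>{0..T}. \<forall>x y z. \<bar>f i t x y z\<bar> \<le> C * (1 + norm x powr q))"

definition switching_costs ::
  "real \<Rightarrow> (real \<Rightarrow> real^'d \<Rightarrow> real^'d) \<Rightarrow> (real \<Rightarrow> real^'d \<Rightarrow> real^'d^'d) \<Rightarrow>
     ('m::finite \<Rightarrow> 'm \<Rightarrow> real \<Rightarrow> real^'d \<Rightarrow> real) \<Rightarrow> bool" where
  "switching_costs T b \<sigma> g \<longleftrightarrow>
     (\<forall>i j. \<forall>t\<in>{0..T}. \<forall>x. g i j t x \<ge> 0) \<and>
     (\<forall>i. \<forall>t\<in>{0..T}. \<forall>x. g i i t x = 0) \<and>
     (\<forall>i j l. i \<noteq> j \<and> j \<noteq> l \<and> i \<noteq> l \<longrightarrow>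
        (\<forall>t\<in>{0..T}. \<forall>x. g i j t x < g i l t x + g l j t x)) \<and>
     (\<forall>i j. \<exists>gt D D2. C12_with T (g i j) gt D D2 \<and>
        (\<forall>t\<in>{0..T}. \<forall>x. gt t x + generator b \<sigma> t x (D t x) (D2 t x) \<le> 0))"

definition terminal_data ::
  "real \<Rightarrow> ('m::finite \<Rightarrow> 'm \<Rightarrow> real \<Rightarrow> real^'d \<Rightarrow> real) \<Rightarrow> ('m \<Rightarrow> real^'d \<Rightarrow> real) \<Rightarrow> bool" where
  "terminal_data T g h \<longleftrightarrow>
     (\<forall>i. h i \<in> borel_measurable borel) \<and>
     (\<exists>C>0. \<exists>p\<ge>0. \<forall>i x. \<bar>h i x\<bar> \<le> C * (1 + norm x powr p)) \<and>
     (\<forall>i j x. j \<noteq> i \<longrightarrow> h i x \<ge> h j x - g i j T x)"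


section \<open>The reflected and the penalized systems\<close>

text \<open>\<open>Y\<^sub>s = \<xi> + \<integral>\<^sub>s\<^sup>T F\<^sub>r dr + K\<^sub>T - K\<^sub>s - \<integral>\<^sub>s\<^sup>T Z\<^sub>r dB\<^sub>r\<close> for all \<open>s \<in> [t,T]\<close>, almost surely.\<close>

definition bsde_equation ::
  "'a measure \<Rightarrow> (real \<Rightarrow> 'a \<Rightarrow> real^'d) \<Rightarrow> real \<Rightarrow> real \<Rightarrow> ('a \<Rightarrow> real) \<Rightarrow> (real \<Rightarrow> 'a \<Rightarrow> real) \<Rightarrow>
     (real \<Rightarrow> 'a \<Rightarrow> real) \<Rightarrow> (real \<Rightarrow> 'a \<Rightarrow> real^'d) \<Rightarrow> (real \<Rightarrow> 'a \<Rightarrow> real) \<Rightarrow> bool" where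
  "bsde_equation M B T t \<xi> F Y Z K \<longleftrightarrow>
     (\<exists>I. has_ito_integral M (brownian_filtration M B) B t T Z I \<and>
        (AE \<omega> in M. \<forall>s\<in>{t..T}.
           Y s \<omega> = \<xi> \<omega> + (LBINT r:{s..T}. F r \<omega>) + K T \<omega> - K s \<omega> - (I T \<omega> - I s \<omega>)))"

definition obstacle ::
  "('m::finite \<Rightarrow> 'm \<Rightarrow> real \<Rightarrow> real^'d \<Rightarrow> real) \<Rightarrow> (real \<Rightarrow> 'a \<Rightarrow> real^'d) \<Rightarrow>
     ('m \<Rightarrow> real \<Rightarrow> 'a \<Rightarrow> real) \<Rightarrow> 'm \<Rightarrow> real \<Rightarrow> 'a \<Rightarrow> real" where
  "obstacle g X Y i s \<omega> = Max ((\<lambda>j. Y j s \<omega> - g i j s (X s \<omega>)) ` (UNIV - {i}))"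

text \<open>The Stieltjes integral against \<open>K\<close> is the integral against the Lebesgue--Stieltjes measure
  of the path of \<open>K\<close> extended by constants outside \<open>[t,T]\<close>.  If there is a single index, the
  set of competing indices is empty and the obstacle conditions are replaced by \<open>K = 0\<close>.\<close>

definition reflected_solution ::
  "'a measure \<Rightarrow> (real \<Rightarrow> 'a \<Rightarrow> real^'d) \<Rightarrow> real \<Rightarrow>
     ('m::finite \<Rightarrow> real \<Rightarrow> real^'d \<Rightarrow> real^'m \<Rightarrow> real^'d^'m \<Rightarrow> real) \<Rightarrow>
     ('m \<Rightarrow> 'm \<Rightarrow> real \<Rightarrow> real^'d \<Rightarrow> real) \<Rightarrow> ('m \<Rightarrow> real^'d \<Rightarrow> real) \<Rightarrow>
     real \<Rightarrow> (real \<Rightarrow> 'a \<Rightarrow> real^'d) \<Rightarrow>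
     ('m \<Rightarrow> real \<Rightarrow> 'a \<Rightarrow> real) \<Rightarrow> ('m \<Rightarrow> real \<Rightarrow> 'a \<Rightarrow> real^'d) \<Rightarrow>
     ('m \<Rightarrow> real \<Rightarrow> 'a \<Rightarrow> real) \<Rightarrow> bool" where
  "reflected_solution M B T f g h t X Y Z K \<longleftrightarrow>
     (\<forall>i. Y i \<in> space_S2 M (brownian_filtration M B) t T \<and>
          Z i \<in> space_H2 M (brownian_filtration M B) t T \<and>
          K i \<in> space_A2 M (brownian_filtration M B) t T) \<and>
     (\<forall>i. bsde_equation M B T t (\<lambda>\<omega>. h i (X T \<omega>))
            (\<lambda>r \<omega>. f i r (X r \<omega>) (\<chi> k. Y k r \<omega>) (\<chi> k. Z k r \<omega>)) (Y i) (Z i) (K i)) \<and>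
     (\<forall>i. if UNIV = {i}
          then (AE \<omega> in M. \<forall>s\<in>{t..T}. K i s \<omega> = 0)
          else (AE \<omega> in M. \<forall>s\<in>{t..T}. Y i s \<omega> \<ge> obstacle g X Y i s \<omega>) \<and>
               (AE \<omega> in M.
                  (LINT s:{t..T}|interval_measure (\<lambda>r. K i (max t (min T r)) \<omega>).
                     Y i s \<omega> - obstacle g X Y i s \<omega>) = 0))"

definition penalty ::
  "('m::finite \<Rightarrow> 'm \<Rightarrow> real \<Rightarrow> real^'d \<Rightarrow> real) \<Rightarrow> (real \<Rightarrow> 'a \<Rightarrow> real^'d) \<Rightarrow>
     ('m \<Rightarrow> real \<Rightarrow> 'a \<Rightarrow> real) \<Rightarrow> 'm \<Rightarrow> 'm \<Rightarrow> real \<Rightarrow> 'a \<Rightarrow> real" where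
  "penalty g X Y i j r \<omega> = max (- (Y i r \<omega> - Y j r \<omega> + g i j r (X r \<omega>))) 0"

definition penalized_solution ::
  "'a measure \<Rightarrow> (real \<Rightarrow> 'a \<Rightarrow> real^'d) \<Rightarrow> real \<Rightarrow>
     ('m::finite \<Rightarrow> real \<Rightarrow> real^'d \<Rightarrow> real^'m \<Rightarrow> real^'d^'m \<Rightarrow> real) \<Rightarrow>
     ('m \<Rightarrow> 'm \<Rightarrow> real \<Rightarrow> real^'d \<Rightarrow> real) \<Rightarrow> ('m \<Rightarrow> real^'d \<Rightarrow> real) \<Rightarrow>
     nat \<Rightarrow> real \<Rightarrow> (real \<Rightarrow> 'a \<Rightarrow> real^'d) \<Rightarrow>
     ('m \<Rightarrow> real \<Rightarrow> 'a \<Rightarrow> real) \<Rightarrow> ('m \<Rightarrow> real \<Rightarrow> 'a \<Rightarrow> real^'d) \<Rightarrow> bool" where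
  "penalized_solution M B T f g h n t X Y Z \<longleftrightarrow>
     (\<forall>i. Y i \<in> space_S2 M (brownian_filtration M B) t T \<and>
          Z i \<in> space_H2 M (brownian_filtration M B) t T) \<and>
     (\<forall>i. bsde_equation M B T t (\<lambda>\<omega>. h i (X T \<omega>))
            (\<lambda>r \<omega>. f i r (X r \<omega>) (\<chi> k. Y k r \<omega>) (\<chi> k. Z k r \<omega>)
                    + real n * (\<Sum>j\<in>UNIV - {i}. penalty g X Y i j r \<omega>))
            (Y i) (Z i) (\<lambda>s \<omega>. 0))"

definition penalized_K ::
  "('m::finite \<Rightarrow> 'm \<Rightarrow> real \<Rightarrow> real^'d \<Rightarrow> real) \<Rightarrow> nat \<Rightarrow> real \<Rightarrow> (real \<Rightarrow> 'a \<Rightarrow> real^'d) \<Rightarrow>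
     ('m \<Rightarrow> real \<Rightarrow> 'a \<Rightarrow> real) \<Rightarrow> 'm \<Rightarrow> real \<Rightarrow> 'a \<Rightarrow> real" where
  "penalized_K g n t X Y i s \<omega> =
     real n * (\<Sum>j\<in>UNIV - {i}. LBINT r:{t..s}. penalty g X Y i j r \<omega>)"

text \<open>\<open>u\<close> and \<open>v\<close> represent \<open>Y\<close> and \<open>Z\<close> as functions of time and the forward process. As an
  element of the space \<open>H\<^sup>2\<close>, \<open>Z\<close> is only determined for almost every time; \<open>Y\<close> is
  represented at every time, so that \<open>u i t x\<close> is the value of \<open>Y i\<close> at the initial time.\<close>

definition markov_representation ::
  "'a measure \<Rightarrow> real \<Rightarrow> (real \<Rightarrow> real^'d \<Rightarrow> real \<Rightarrow> 'a \<Rightarrow> real^'d) \<Rightarrow>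
     (real \<Rightarrow> real^'d \<Rightarrow> 'm::finite \<Rightarrow> real \<Rightarrow> 'a \<Rightarrow> real) \<Rightarrow>
     (real \<Rightarrow> real^'d \<Rightarrow> 'm \<Rightarrow> real \<Rightarrow> 'a \<Rightarrow> real^'d) \<Rightarrow>
     ('m \<Rightarrow> real \<Rightarrow> real^'d \<Rightarrow> real) \<Rightarrow> ('m \<Rightarrow> real \<Rightarrow> real^'d \<Rightarrow> real^'d) \<Rightarrow> bool" where
  "markov_representation M T X Y Z u v \<longleftrightarrow>
     (\<forall>i. (\<lambda>(t, x). u i t x) \<in> borel_measurable (restrict_space borel ({0..T} \<times> UNIV)) \<and>
          (\<lambda>(t, x). v i t x) \<in> borel_measurable (restrict_space borel ({0..T} \<times> UNIV))) \<and>
     (\<forall>i. \<forall>t\<in>{0..T}. \<forall>x.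
        (\<forall>s\<in>{t..T}. AE \<omega> in M. Y t x i s \<omega> = u i s (X t x s \<omega>)) \<and>
        (AE \<omega> in M. AE s in lborel. s \<in> {t..T} \<longrightarrow> Z t x i s \<omega> = v i s (X t x s \<omega>)))"

end

theory Submission
  imports Defs
begin

text \<open>The function \<open>u\<close> is the pointwise limit of the \<open>un (nn j)\<close>.  For \<open>v\<close> no pointwise limit is
  available: \<open>Z\<close> is only an \<open>L\<^sup>2\<close>-limit, and almost everywhere convergent subsequences depend a priori
  on the starting point.  One therefore extracts a subsequence of the \<open>vn (nn j)\<close> that converges
  almost everywhere for the process started at the reference point \<open>(0, x0)\<close> of the domination
  condition.  Since the occupation measure of the process started at any \<open>(t, x)\<close> is absolutely
  continuous on \<open>[t + \<delta>, T]\<close> with respect to the reference one, the same subsequence converges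
  almost everywhere for every starting point.\<close>

section \<open>Almost everywhere limits of L2-convergent sequences\<close>

text \<open>The real functions \<open>(norm (w n x - z x))\<^sup>2\<close> tend to 0 in L1, so the
  L1 subsequence theorem applies to them; neither \<open>w n\<close> nor \<open>z\<close> itself is
  assumed square integrable.\<close>

lemma L2_tendsto_AE_subseq:
  fixes w :: "nat \<Rightarrow> 'a \<Rightarrow> 'b::{banach, second_countable_topology}"
  assumes [measurable]: "\<And>n. w n \<in> borel_measurable M" "z \<in> borel_measurable M"
    and lim: "(\<lambda>n. \<integral>\<^sup>+x. ennreal ((norm (w n x - z x))\<^sup>2) \<partial>M) \<longlonglongrightarrow> 0"
  obtains r where "strict_mono r" "AE x in M. (\<lambda>n. w (r n) x) \<longlonglongrightarrow> z x"
proof -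
  have "eventually (\<lambda>n. (\<integral>\<^sup>+x. ennreal ((norm (w n x - z x))\<^sup>2) \<partial>M) < 1) sequentially"
    using lim by (rule order_tendstoD) simp
  then obtain N where N: "\<And>n. n \<ge> N \<Longrightarrow> (\<integral>\<^sup>+x. ennreal ((norm (w n x - z x))\<^sup>2) \<partial>M) < 1"
    by (auto simp: eventually_sequentially)
  \<comment> \<open>Finitely many of the integrals may be infinite. The shift by \<open>N\<close>
    discards them, since the L1 theorem asks for integrability at every index.\<close>
  let ?u = "\<lambda>n x. (norm (w (n + N) x - z x))\<^sup>2"
  have int: "integrable M (?u n)" for n
    using N[of "n + N"] by (intro integrableI_nonneg) (auto intro: less_trans)
  have "(\<lambda>n. enn2real (\<integral>\<^sup>+x. ennreal (?u n x) \<partial>M)) \<longlonglongrightarrow> 0"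
    using LIMSEQ_ignore_initial_segment[OF lim, of N] by (intro tendsto_enn2real) auto
  then have "(\<lambda>n. \<integral>x. norm (?u n x) \<partial>M) \<longlonglongrightarrow> 0"
    by (simp add: integral_eq_nn_integral)
  from tendsto_L1_AE_subseq[OF int this]
  obtain r where r: "strict_mono r" "AE x in M. (\<lambda>n. ?u (r n) x) \<longlonglongrightarrow> 0"
    by auto
  show thesis
  proof
    show "strict_mono (\<lambda>n. r n + N)"
      using r(1) by (simp add: strict_mono_def)
    show "AE x in M. (\<lambda>n. w (r n + N) x) \<longlonglongrightarrow> z x"
      using r(2)
    proof eventually_elim
      case (elim x)
      then have "(\<lambda>n. sqrt (?u (r n) x)) \<longlonglongrightarrow> sqrt 0"
        by (rule tendsto_real_sqrt)
      then show ?case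
        by (simp add: LIM_zero_iff tendsto_norm_zero_iff)
    qed
  qed
qed

text \<open>Along a suitable subsequence \<open>w\<close> tends almost everywhere both to the L2
  limit and to the pointwise limit, and limits are unique. This identifies \<open>Y\<close> and
  \<open>Z\<close> once a pointwise limit of their approximations is at hand.\<close>

lemma L2_limit_eq_AE_limit:
  fixes w :: "nat \<Rightarrow> 'a \<Rightarrow> 'b::{banach, second_countable_topology}"
  assumes "\<And>n. w n \<in> borel_measurable M" "z \<in> borel_measurable M"
    and "(\<lambda>n. \<integral>\<^sup>+x. ennreal ((norm (w n x - z x))\<^sup>2) \<partial>M) \<longlonglongrightarrow> 0"
    and ae: "AE x in M. (\<lambda>n. w n x) \<longlonglongrightarrow> w' x"
  shows "AE x in M. z x = w' x"
proof -
  obtain r where r: "strict_mono r" "AE x in M. (\<lambda>n. w (r n) x) \<longlonglongrightarrow> z x"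
    using L2_tendsto_AE_subseq assms(1-3) by blast
  from r(2) ae show ?thesis
  proof eventually_elim
    case (elim x)
    from LIMSEQ_subseq_LIMSEQ[OF elim(2) r(1)] have "(\<lambda>n. w (r n) x) \<longlonglongrightarrow> w' x"
      by (simp add: comp_def)
    with elim(1) show ?case
      by (rule LIMSEQ_unique)
  qed
qed

section \<open>Joint measurability of progressive processes in time and scenario\<close>

text \<open>Members of \<open>null_sets M\<close> lie in \<open>sets M\<close> by definition, so the
  augmentation does not leave \<open>sets M\<close>; the bound \<open>t \<le> T\<close> keeps the
  times of the generators in the range where \<open>B\<close> is measurable.\<close>

lemma sets_brownian_filtration_subset:
  assumes "\<forall>s\<in>{0..T}. B s \<in> borel_measurable M" and "t \<le> T"
  shows "sets (brownian_filtration M B t) \<subseteq> sets M"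
proof -
  let ?G = "(\<Union>s\<in>{0..t}. {B s -` A \<inter> space M | A. A \<in> sets borel}) \<union> null_sets M"
  have "?G \<subseteq> sets M"
    using assms by (auto intro!: measurable_sets)
  then have "sigma_sets (space M) ?G \<subseteq> sets M"
    by (rule sets.sigma_sets_subset)
  moreover have "?G \<subseteq> Pow (space M)"
    using \<open>?G \<subseteq> sets M\<close> sets.space_closed by blast
  ultimately show ?thesis
    unfolding brownian_filtration_def by (simp add: sets_measure_of)
qed

text \<open>Progressive measurability at the terminal time \<open>T\<close> gives joint
  measurability for the sigma-algebra at \<open>T\<close>, which is contained in that of
  \<open>M\<close>. This is the form that the Fubini and Tonelli arguments use.\<close>

lemma progressive_imp_pair_measurable:
  fixes H :: "real \<Rightarrow> 'a \<Rightarrow> 'b::topological_space"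
  assumes B: "brownian_motion M T B" and "t \<le> T"
    and prog: "progressive (brownian_filtration M B) t T H"
  shows "(\<lambda>(r, \<omega>). H r \<omega>) \<in> borel_measurable (restrict_space lborel {t..T} \<Otimes>\<^sub>M M)"
proof -
  let ?F = "brownian_filtration M B T"
  have "sets ?F \<subseteq> sets M"
    using B by (intro sets_brownian_filtration_subset[where T = T]) (auto simp: brownian_motion_def)
  moreover have "space ?F = space M"
    by (simp add: brownian_filtration_def space_measure_of_conv)
  ultimately have id: "(\<lambda>\<omega>. \<omega>) \<in> measurable M ?F"
    by (auto simp: measurable_def sets.Int_space_eq1)
  have "(\<lambda>p. (fst p, snd p)) \<in> measurable (restrict_space lborel {t..T} \<Otimes>\<^sub>M M)
      (restrict_space borel {t..T} \<Otimes>\<^sub>M ?F)"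
  proof (rule measurable_Pair)
    show "fst \<in> measurable (restrict_space lborel {t..T} \<Otimes>\<^sub>M M) (restrict_space borel {t..T})"
      by (subst measurable_cong_sets[OF _ sets_restrict_space_cong[of borel lborel]]) auto
    show "snd \<in> measurable (restrict_space lborel {t..T} \<Otimes>\<^sub>M M) ?F"
      by (rule measurable_compose[OF measurable_snd id])
  qed
  moreover have "(\<lambda>(r, \<omega>). H r \<omega>) \<in> borel_measurable (restrict_space borel {t..T} \<Otimes>\<^sub>M ?F)"
    using prog \<open>t \<le> T\<close> by (auto simp: progressive_def)
  ultimately show ?thesis
    by (auto dest: measurable_compose)
qed

lemma time_state_pair_measurable:
  fixes X :: "real \<Rightarrow> 'a \<Rightarrow> 'c::second_countable_topology"
  assumes X: "(\<lambda>(s, \<omega>). X s \<omega>) \<in> borel_measurable (restrict_space lborel {t..T} \<Otimes>\<^sub>M M)"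
  shows "(\<lambda>p. (fst p, X (fst p) (snd p))) \<in> borel_measurable (restrict_space lborel {t..T} \<Otimes>\<^sub>M M)"
proof -
  let ?L = "restrict_space lborel {t..T}"
  have "(\<lambda>p. X (fst p) (snd p)) \<in> borel_measurable (?L \<Otimes>\<^sub>M M)"
    using X by (simp add: case_prod_unfold)
  moreover have "fst \<in> borel_measurable (?L \<Otimes>\<^sub>M M)"
    by (rule measurable_compose[OF measurable_fst measurable_restrict_space1]) simp
  ultimately show ?thesis
    by (intro borel_measurable_Pair) auto
qed

lemma section_measurable:
  assumes "(\<lambda>(r, \<omega>). H r \<omega>) \<in> measurable (restrict_space lborel {t..T} \<Otimes>\<^sub>M M) N"
    and "s \<in> {t..T}"
  shows "H s \<in> measurable M N"
proof -
  have "(\<lambda>\<omega>. (s, \<omega>)) \<in> measurable M (restrict_space lborel {t..T} \<Otimes>\<^sub>M M)"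
    using assms(2) by (intro measurable_Pair1') (simp add: space_restrict_space)
  from measurable_compose[OF this assms(1)] show ?thesis
    by simp
qed

lemma sigma_finite_restrict_lborel:
  "sigma_finite_measure (restrict_space lborel {t..T::real})"
  by (intro sigma_finite_measure_restrict_space) (auto simp: sigma_finite_lborel)

lemma AE_restrict_lborel_interval:
  "(AE s in restrict_space lborel {t..T::real}. P s) \<longleftrightarrow> (AE s in lborel. s \<in> {t..T} \<longrightarrow> P s)"
  by (subst AE_restrict_space_iff) auto

section \<open>Transfer of null sets between starting points\<close>

text \<open>The density identity with \<open>A = N\<close> shows that a set null for the occupation
  measure of the reference process is null for that of any other start on
  \<open>[t + \<delta>, T]\<close>; then \<delta> tends to 0. The point \<open>x0\<close> is
  quantified before \<open>N\<close>, \<open>t\<close> and \<open>x\<close>, so a single reference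
  start serves all of them.\<close>

lemma L2_domination_null_sets:
  fixes X :: "real \<Rightarrow> real^'d \<Rightarrow> real \<Rightarrow> 'a \<Rightarrow> real^'d"
  assumes "prob_space M" and dom: "L2_domination M T X"
    and X: "\<And>t x. t \<in> {0..T} \<Longrightarrow>
      (\<lambda>(s, \<omega>). X t x s \<omega>) \<in> borel_measurable (restrict_space lborel {t..T} \<Otimes>\<^sub>M M)"
  shows "\<exists>x0. \<forall>N\<in>sets borel. \<forall>t\<in>{0..T}. \<forall>x.
      (AE s in lborel. s \<in> {0..T} \<longrightarrow> (AE \<omega> in M. (s, X 0 x0 s \<omega>) \<notin> N)) \<longrightarrow>
      (AE s in lborel. s \<in> {t..T} \<longrightarrow> (AE \<omega> in M. (s, X t x s \<omega>) \<notin> N))"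
proof -
  interpret prob_space M by fact
  obtain x0 where x0: "\<And>t x \<delta>. t \<in> {0..T} \<Longrightarrow> \<delta> > 0 \<Longrightarrow> t + \<delta> \<le> T \<Longrightarrow>
      \<exists>\<phi> :: real \<Rightarrow> real^'d \<Rightarrow> real. \<forall>A\<in>sets borel.
        (\<integral>\<^sup>+s\<in>{t+\<delta>..T}. emeasure (forward_law M X t x s) {y. (s, y) \<in> A} \<partial>lborel) =
        (\<integral>\<^sup>+s\<in>{t+\<delta>..T}.
          (\<integral>\<^sup>+y. ennreal (\<phi> s y) * indicator A (s, y) \<partial>forward_law M X 0 x0 s) \<partial>lborel)"
    using dom unfolding L2_domination_def by meson
  show ?thesis
  proof (intro exI[of _ x0] ballI allI impI)
    fix N :: "(real \<times> (real^'d)) set" and t x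
    assume N[measurable]: "N \<in> sets borel" and t: "t \<in> {0..T}"
      and null: "AE s in lborel. s \<in> {0..T} \<longrightarrow> (AE \<omega> in M. (s, X 0 x0 s \<omega>) \<notin> N)"
    have Xs: "X t' x' s \<in> borel_measurable M" if "t' \<in> {0..T}" "s \<in> {t'..T}" for t' x' s
      using section_measurable[OF X[OF that(1)] that(2)] .
    have Ns: "{y. (s, y) \<in> N} \<in> sets borel" for s
    proof -
      have "Pair s -` N \<inter> space borel \<in> sets borel"
        by (rule measurable_sets[OF borel_measurable_Pair N]) auto
      then show ?thesis
        by (simp add: vimage_def)
    qed
    let ?L = "restrict_space lborel {t..T}"
    \<comment> \<open>Measurability in \<open>s\<close> is what turns a vanishing integral into
      vanishing almost everywhere. The paths are controlled on \<open>[t,T]\<close> only, hence the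
      restricted Lebesgue measure.\<close>
    have meas: "(\<lambda>s. emeasure M {\<omega>\<in>space M. (s, X t x s \<omega>) \<in> N}) \<in> borel_measurable ?L"
    proof -
      let ?Q = "{p \<in> space (?L \<Otimes>\<^sub>M M). (fst p, X t x (fst p) (snd p)) \<in> N}"
      have "(\<lambda>p. (fst p, X t x (fst p) (snd p))) \<in> borel_measurable (?L \<Otimes>\<^sub>M M)"
        by (rule time_state_pair_measurable[OF X[OF t]])
      then have "?Q \<in> sets (?L \<Otimes>\<^sub>M M)"
        using measurable_sets[OF _ N] by (simp add: vimage_def Int_def conj_commute)
      then have "(\<lambda>s. emeasure M (Pair s -` ?Q)) \<in> borel_measurable ?L"
        by (rule measurable_emeasure_Pair)
      also have "?this \<longleftrightarrow> ?thesis"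
        by (rule measurable_cong)
          (auto simp: space_pair_measure intro!: arg_cong[where f = "emeasure M"])
      finally show ?thesis .
    qed
    have step: "AE s in lborel. s \<in> {t + \<delta>..T} \<longrightarrow> (AE \<omega> in M. (s, X t x s \<omega>) \<notin> N)"
      if "\<delta> > 0" for \<delta>
    proof (cases "t + \<delta> \<le> T")
      case True
      obtain \<phi> where \<phi>:
        "(\<integral>\<^sup>+s\<in>{t+\<delta>..T}. emeasure (forward_law M X t x s) {y. (s, y) \<in> N} \<partial>lborel) =
         (\<integral>\<^sup>+s\<in>{t+\<delta>..T}. (\<integral>\<^sup>+y. ennreal (\<phi> s y) * indicator N (s, y)
            \<partial>forward_law M X 0 x0 s) \<partial>lborel)"
        using x0[OF t \<open>\<delta> > 0\<close> True] N by meson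
      \<comment> \<open>For almost every \<open>s\<close> the slice of \<open>N\<close> at
        \<open>s\<close> is null under the reference law, so the inner integral is 0 whatever the
        density is.\<close>
      have "(\<integral>\<^sup>+s\<in>{t+\<delta>..T}. (\<integral>\<^sup>+y. ennreal (\<phi> s y) * indicator N (s, y)
            \<partial>forward_law M X 0 x0 s) \<partial>lborel) = (\<integral>\<^sup>+s. 0 \<partial>(lborel :: real measure))"
      proof (rule nn_integral_cong_AE, use null in eventually_elim)
        case (elim s)
        show ?case
        proof (cases "s \<in> {t+\<delta>..T}")
          case True
          then have s: "s \<in> {0..T}" using t \<open>\<delta> > 0\<close> by auto
          have "AE y in forward_law M X 0 x0 s. (s, y) \<notin> N"
            unfolding forward_law_def using elim s t Ns[of s]
            by (subst AE_distr_iff) (auto simp: Collect_neg_eq intro!: Xs)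
          then have "(\<integral>\<^sup>+y. ennreal (\<phi> s y) * indicator N (s, y) \<partial>forward_law M X 0 x0 s)
              = (\<integral>\<^sup>+y. 0 \<partial>forward_law M X 0 x0 s)"
            by (intro nn_integral_cong_AE) auto
          then show ?thesis by simp
        qed simp
      qed
      with \<phi> have "(\<integral>\<^sup>+s\<in>{t+\<delta>..T}. emeasure (forward_law M X t x s) {y. (s, y) \<in> N} \<partial>lborel) = 0"
        by simp
      \<comment> \<open>The law is pulled back to \<open>M\<close>. The factor
        \<open>indicator {t..T} s\<close> changes nothing, because \<open>{t+\<delta>..T}\<close>
        lies inside \<open>{t..T}\<close>, and makes the integral one over
        \<open>?L\<close>.\<close>
      also have "(\<integral>\<^sup>+s\<in>{t+\<delta>..T}. emeasure (forward_law M X t x s) {y. (s, y) \<in> N} \<partial>lborel)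
          = (\<integral>\<^sup>+s. emeasure M {\<omega>\<in>space M. (s, X t x s \<omega>) \<in> N} * indicator {t+\<delta>..T} s
               * indicator {t..T} s \<partial>lborel)"
        using t \<open>\<delta> > 0\<close> Ns
        by (intro nn_integral_cong)
          (auto simp: forward_law_def emeasure_distr Xs indicator_def vimage_def
             intro!: arg_cong[where f = "emeasure M"])
      also have "\<dots> = (\<integral>\<^sup>+s. emeasure M {\<omega>\<in>space M. (s, X t x s \<omega>) \<in> N} * indicator {t+\<delta>..T} s \<partial>?L)"
        by (subst nn_integral_restrict_space) auto
      finally have "AE s in ?L. emeasure M {\<omega>\<in>space M. (s, X t x s \<omega>) \<in> N}
          * indicator {t+\<delta>..T} s = 0"
        by (subst (asm) nn_integral_0_iff_AE[OF borel_measurable_times_ennreal[OF meas]])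
          (auto intro: measurable_restrict_space1)
      then have "AE s in lborel. s \<in> {t..T} \<longrightarrow> emeasure M {\<omega>\<in>space M. (s, X t x s \<omega>) \<in> N}
          * indicator {t+\<delta>..T} s = 0"
        by (simp add: AE_restrict_lborel_interval)
      then show ?thesis
      proof eventually_elim
        case (elim s)
        show ?case
        proof
          assume s: "s \<in> {t + \<delta>..T}"
          with elim \<open>\<delta> > 0\<close> have "emeasure M {\<omega>\<in>space M. (s, X t x s \<omega>) \<in> N} = 0"
            by auto
          moreover have "X t x s -` {y. (s, y) \<in> N} \<inter> space M \<in> sets M"
            using s \<open>\<delta> > 0\<close> t by (intro measurable_sets[OF Xs Ns]) auto
          then have "{\<omega>\<in>space M. (s, X t x s \<omega>) \<in> N} \<in> sets M"
            by (simp add: vimage_def Int_def conj_commute)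
          ultimately show "AE \<omega> in M. (s, X t x s \<omega>) \<notin> N"
            by (intro AE_I'[of "{\<omega>\<in>space M. (s, X t x s \<omega>) \<in> N}"]) auto
        qed
      qed
    qed auto
    \<comment> \<open>Countably many values of \<delta> suffice: the intervals
      \<open>{t + 1 / Suc n..T}\<close> exhaust \<open>[t,T]\<close> up to the single time
      \<open>t\<close>, which is Lebesgue null.\<close>
    have "AE s in lborel. \<forall>n::nat. s \<in> {t + 1 / Suc n..T} \<longrightarrow> (AE \<omega> in M. (s, X t x s \<omega>) \<notin> N)"
      unfolding AE_all_countable by (intro allI step) simp
    moreover have "AE s in lborel. s \<noteq> t"
      by (rule AE_lborel_singleton)
    ultimately show "AE s in lborel. s \<in> {t..T} \<longrightarrow> (AE \<omega> in M. (s, X t x s \<omega>) \<notin> N)"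
    proof eventually_elim
      case (elim s)
      show ?case
      proof
        assume "s \<in> {t..T}"
        with elim(2) have "0 < s - t" by auto
        then obtain n where "1 / real (Suc n) < s - t"
          by (rule nat_approx_posE)
        then have "s \<in> {t + 1 / Suc n..T}"
          using \<open>s \<in> {t..T}\<close> by simp
        with elim(1) show "AE \<omega> in M. (s, X t x s \<omega>) \<notin> N" by blast
      qed
    qed
  qed
qed

section \<open>Fubini for equalities, and composition with the forward process\<close>

text \<open>The set where two jointly measurable functions agree is measurable, as the target space
  is Hausdorff and second countable, so Fubini exchanges the two quantifiers. It yields the order
  required in the theorem: almost surely, for almost every time.\<close>

lemma AE_AE_eq_commute:
  fixes f g :: "real \<Rightarrow> 'a \<Rightarrow> 'b::{second_countable_topology, t2_space}"
  assumes "prob_space M"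
    and "(\<lambda>(s, \<omega>). f s \<omega>) \<in> borel_measurable (restrict_space lborel {t..T} \<Otimes>\<^sub>M M)"
    and "(\<lambda>(s, \<omega>). g s \<omega>) \<in> borel_measurable (restrict_space lborel {t..T} \<Otimes>\<^sub>M M)"
    and ae: "AE s in lborel. s \<in> {t..T} \<longrightarrow> (AE \<omega> in M. f s \<omega> = g s \<omega>)"
  shows "AE \<omega> in M. AE s in lborel. s \<in> {t..T} \<longrightarrow> f s \<omega> = g s \<omega>"
proof -
  interpret prob_space M by fact
  let ?L = "restrict_space lborel {t..T}"
  interpret LM: pair_sigma_finite ?L M
    by (simp add: pair_sigma_finite_def sigma_finite_restrict_lborel sigma_finite_measure_axioms)
  have [measurable]: "(\<lambda>p. f (fst p) (snd p)) \<in> borel_measurable (?L \<Otimes>\<^sub>M M)"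
    "(\<lambda>p. g (fst p) (snd p)) \<in> borel_measurable (?L \<Otimes>\<^sub>M M)"
    using assms(2,3) by (simp_all add: case_prod_unfold)
  have "{p\<in>space (?L \<Otimes>\<^sub>M M). f (fst p) (snd p) = g (fst p) (snd p)} \<in> sets (?L \<Otimes>\<^sub>M M)"
    by measurable
  from LM.AE_commute[OF this] ae show ?thesis
    by (simp only: AE_restrict_lborel_interval)
qed

text \<open>Measurability of \<open>w\<close> is known on \<open>[0,T]\<close> times the state space
  only; \<open>0 \<le> t\<close> ensures that the pair of time and state takes its values
  there.\<close>

lemma feedback_pair_measurable:
  fixes X :: "real \<Rightarrow> 'a \<Rightarrow> 'c::second_countable_topology"
    and w :: "real \<Rightarrow> 'c \<Rightarrow> 'b::topological_space"
  assumes w: "(\<lambda>(s, y). w s y) \<in> borel_measurable (restrict_space borel ({0..T} \<times> UNIV))"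
    and X: "(\<lambda>(s, \<omega>). X s \<omega>) \<in> borel_measurable (restrict_space lborel {t..T} \<Otimes>\<^sub>M M)"
    and "0 \<le> t"
  shows "(\<lambda>(s, \<omega>). w s (X s \<omega>)) \<in> borel_measurable (restrict_space lborel {t..T} \<Otimes>\<^sub>M M)"
proof -
  let ?L = "restrict_space lborel {t..T}"
  have "(\<lambda>p. (fst p, X (fst p) (snd p))) \<in> borel_measurable (?L \<Otimes>\<^sub>M M)"
    by (rule time_state_pair_measurable[OF X])
  then have "(\<lambda>p. (fst p, X (fst p) (snd p)))
      \<in> measurable (?L \<Otimes>\<^sub>M M) (restrict_space borel ({0..T} \<times> UNIV))"
    using \<open>0 \<le> t\<close> by (intro measurable_restrict_space2)
      (auto simp: space_pair_measure space_restrict_space)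
  from measurable_compose[OF this w] show ?thesis
    by (simp add: case_prod_unfold)
qed

text \<open>By completeness, convergence is the Cauchy property, a countable combination of
  measurable conditions.\<close>

lemma sets_not_convergent:
  fixes w :: "nat \<Rightarrow> 'a \<Rightarrow> 'b::{banach, second_countable_topology}"
  assumes [measurable]: "\<And>n. w n \<in> borel_measurable M"
  shows "{x\<in>space M. \<not> convergent (\<lambda>n. w n x)} \<in> sets M"
  unfolding Cauchy_convergent_iff[symmetric]
  by (intro sets.sets_Collect_neg sets_Collect_Cauchy) measurable

section \<open>One feedback function for all starting points\<close>

text \<open>The set where a sequence of feedback functions fails to converge is a deterministic
  subset of time and space. If the reference process avoids it almost everywhere, so does every
  other start, and there the pointwise limit must coincide with the L2 limit
  \<open>Z\<close>.\<close>

lemma common_feedback_limit: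
  fixes X :: "real \<Rightarrow> real^'d \<Rightarrow> real \<Rightarrow> 'a \<Rightarrow> real^'d"
    and w :: "nat \<Rightarrow> real \<Rightarrow> real^'d \<Rightarrow> 'b::{banach, second_countable_topology}"
    and Z :: "real \<Rightarrow> real^'d \<Rightarrow> real \<Rightarrow> 'a \<Rightarrow> 'b"
  assumes M: "prob_space M" and T: "0 \<le> T" and dom: "L2_domination M T X"
    and X: "\<And>t x. t \<in> {0..T} \<Longrightarrow>
      (\<lambda>(s, \<omega>). X t x s \<omega>) \<in> borel_measurable (restrict_space lborel {t..T} \<Otimes>\<^sub>M M)"
    and Z: "\<And>t x. t \<in> {0..T} \<Longrightarrow>
      (\<lambda>(s, \<omega>). Z t x s \<omega>) \<in> borel_measurable (restrict_space lborel {t..T} \<Otimes>\<^sub>M M)"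
    and w: "\<And>n. (\<lambda>(s, y). w n s y) \<in> borel_measurable (restrict_space borel ({0..T} \<times> UNIV))"
    and lim: "\<And>t x. t \<in> {0..T} \<Longrightarrow>
      (\<lambda>n. \<integral>\<^sup>+\<omega>. (\<integral>\<^sup>+s\<in>{t..T}. ennreal ((norm (w n s (X t x s \<omega>) - Z t x s \<omega>))\<^sup>2) \<partial>lborel) \<partial>M)
        \<longlonglongrightarrow> 0"
  shows "\<exists>v. (\<lambda>(s, y). v s y) \<in> borel_measurable (restrict_space borel ({0..T} \<times> UNIV)) \<and>
    (\<forall>t\<in>{0..T}. \<forall>x. AE \<omega> in M. AE s in lborel. s \<in> {t..T} \<longrightarrow> Z t x s \<omega> = v s (X t x s \<omega>))"
proof -
  interpret prob_space M by fact
  let ?L = "\<lambda>t. restrict_space lborel {t..T}"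
  have pair: "pair_sigma_finite (?L t) M" for t
    by (simp add: pair_sigma_finite_def sigma_finite_restrict_lborel sigma_finite_measure_axioms)
  let ?W = "\<lambda>t x n p. w n (fst p) (X t x (fst p) (snd p))"
  let ?Z = "\<lambda>t x p. Z t x (fst p) (snd p)"
  have W: "?W t x n \<in> borel_measurable (?L t \<Otimes>\<^sub>M M)" if "t \<in> {0..T}" for t x n
    using feedback_pair_measurable[OF w X[OF that]] that by (simp add: case_prod_unfold)
  have Z': "?Z t x \<in> borel_measurable (?L t \<Otimes>\<^sub>M M)" if "t \<in> {0..T}" for t x
    using Z[OF that] by (simp add: case_prod_unfold)
  \<comment> \<open>Tonelli rewrites the iterated integral as one over the product of time and
    scenario, the measure on which the subsequence lemmas are applied.\<close>
  have L2: "(\<lambda>n. \<integral>\<^sup>+p. ennreal ((norm (?W t x n p - ?Z t x p))\<^sup>2) \<partial>(?L t \<Otimes>\<^sub>M M)) \<longlonglongrightarrow> 0"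
    if t: "t \<in> {0..T}" for t x
  proof -
    have "(\<integral>\<^sup>+\<omega>. (\<integral>\<^sup>+s\<in>{t..T}. ennreal ((norm (w n s (X t x s \<omega>) - Z t x s \<omega>))\<^sup>2) \<partial>lborel) \<partial>M)
        = (\<integral>\<^sup>+p. ennreal ((norm (?W t x n p - ?Z t x p))\<^sup>2) \<partial>(?L t \<Otimes>\<^sub>M M))" for n
    proof -
      have "(\<lambda>p. ennreal ((norm (?W t x n p - ?Z t x p))\<^sup>2)) \<in> borel_measurable (?L t \<Otimes>\<^sub>M M)"
      proof -
        have [measurable]: "?W t x n \<in> borel_measurable (?L t \<Otimes>\<^sub>M M)"
          "?Z t x \<in> borel_measurable (?L t \<Otimes>\<^sub>M M)"
          by (rule W[OF t] Z'[OF t])+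
        show ?thesis by measurable
      qed
      from pair_sigma_finite.nn_integral_snd[OF pair this] show ?thesis
        by (simp add: nn_integral_restrict_space)
    qed
    with lim[OF t, of x] show ?thesis by simp
  qed
  have "\<exists>x0. \<forall>N\<in>sets borel. \<forall>t\<in>{0..T}. \<forall>x.
      (AE s in lborel. s \<in> {0..T} \<longrightarrow> (AE \<omega> in M. (s, X 0 x0 s \<omega>) \<notin> N)) \<longrightarrow>
      (AE s in lborel. s \<in> {t..T} \<longrightarrow> (AE \<omega> in M. (s, X t x s \<omega>) \<notin> N))"
    by (rule L2_domination_null_sets[OF M dom X])
  then obtain x0 where x0: "\<forall>N\<in>sets borel. \<forall>t\<in>{0..T}. \<forall>x.
      (AE s in lborel. s \<in> {0..T} \<longrightarrow> (AE \<omega> in M. (s, X 0 x0 s \<omega>) \<notin> N)) \<longrightarrow>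
      (AE s in lborel. s \<in> {t..T} \<longrightarrow> (AE \<omega> in M. (s, X t x s \<omega>) \<notin> N))" ..
  have T0: "0 \<in> {0..T}" using T by simp
  \<comment> \<open>This is the only extraction of a subsequence that enters the definition of
    \<open>v\<close>, and it is made at the reference start \<open>(0, x0)\<close>.\<close>
  obtain r where r: "strict_mono r"
    "AE p in ?L 0 \<Otimes>\<^sub>M M. (\<lambda>n. ?W 0 x0 (r n) p) \<longlonglongrightarrow> ?Z 0 x0 p"
    by (rule L2_tendsto_AE_subseq[OF W[OF T0] Z'[OF T0] L2[OF T0]])
  let ?R = "restrict_space (borel :: (real \<times> (real^'d)) measure) ({0..T} \<times> UNIV)"
  \<comment> \<open>On \<open>N\<close>, the set of non-convergence, \<open>lim\<close> is a fixed
    unspecified value, so \<open>v\<close> is defined everywhere and remains measurable.\<close>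
  define v where "v s y = lim (\<lambda>n. w (r n) s y)" for s y
  define N where "N = {p\<in>space ?R. \<not> convergent (\<lambda>n. (\<lambda>(s, y). w (r n) s y) p)}"
  have "N \<in> sets ?R"
    unfolding N_def by (rule sets_not_convergent) (rule w)
  \<comment> \<open>A measurable subset of the closed strip \<open>{0..T} \<times> UNIV\<close> is
    Borel in the whole space, as the null set transfer requires.\<close>
  then have N: "N \<in> sets borel"
    by (subst (asm) sets_restrict_space_iff) (auto intro!: borel_closed closed_Times)
  have "(\<lambda>p. lim (\<lambda>n. (\<lambda>(s, y). w (r n) s y) p)) \<in> borel_measurable ?R"
    by (rule borel_measurable_lim_metric) (rule w)
  then have v: "(\<lambda>(s, y). v s y) \<in> borel_measurable ?R"
    by (simp add: v_def case_prod_unfold)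
  have "AE p in ?L 0 \<Otimes>\<^sub>M M. (fst p, X 0 x0 (fst p) (snd p)) \<notin> N"
    using r(2) by eventually_elim (auto simp: N_def convergent_def)
  then have "AE s in ?L 0. AE \<omega> in M. (s, X 0 x0 s \<omega>) \<notin> N"
    by (auto dest: pair_sigma_finite.AE_pair[OF pair])
  then have null: "AE s in lborel. s \<in> {0..T} \<longrightarrow> (AE \<omega> in M. (s, X 0 x0 s \<omega>) \<notin> N)"
    by (simp only: AE_restrict_lborel_interval)
  have "AE \<omega> in M. AE s in lborel. s \<in> {t..T} \<longrightarrow> Z t x s \<omega> = v s (X t x s \<omega>)"
    if t: "t \<in> {0..T}" for t x
  proof -
    interpret LM: pair_sigma_finite "?L t" M by (rule pair)
    let ?V = "\<lambda>p. v (fst p) (X t x (fst p) (snd p))"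
    have V: "?V \<in> borel_measurable (?L t \<Otimes>\<^sub>M M)"
      using feedback_pair_measurable[OF v X[OF t]] t by (simp add: case_prod_unfold)
    have ae: "AE s in ?L t. AE \<omega> in M. (s, X t x s \<omega>) \<notin> N"
      unfolding AE_restrict_lborel_interval using x0 N t null by blast
    \<comment> \<open>Passing from the iterated statement to the product measure requires
      measurability of the exceptional set, obtained from that of \<open>N\<close>.\<close>
    have "AE p in ?L t \<Otimes>\<^sub>M M. (fst p, X t x (fst p) (snd p)) \<notin> N"
    proof (rule LM.AE_pair_measure)
      have "(\<lambda>p. (fst p, X t x (fst p) (snd p))) -` (- N) \<inter> space (?L t \<Otimes>\<^sub>M M) \<in> sets (?L t \<Otimes>\<^sub>M M)"
        using N by (intro measurable_sets[OF time_state_pair_measurable[OF X[OF t]]]) auto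
      then show "{p\<in>space (?L t \<Otimes>\<^sub>M M). (fst p, X t x (fst p) (snd p)) \<notin> N} \<in> sets (?L t \<Otimes>\<^sub>M M)"
        by (simp add: vimage_def Int_def conj_commute)
    qed (use ae in simp)
    \<comment> \<open>Avoiding \<open>N\<close> means convergence only at points of the strip;
      \<open>AE_space\<close> supplies that the time lies in \<open>[t,T]\<close>, hence in
      \<open>[0,T]\<close>.\<close>
    with AE_space have "AE p in ?L t \<Otimes>\<^sub>M M. (\<lambda>n. ?W t x (r n) p) \<longlonglongrightarrow> ?V p"
      by eventually_elim
        (use t in \<open>auto simp: N_def v_def space_restrict_space space_pair_measure convergent_LIMSEQ_iff\<close>)
    moreover have "(\<lambda>n. \<integral>\<^sup>+p. ennreal ((norm (?W t x (r n) p - ?Z t x p))\<^sup>2) \<partial>(?L t \<Otimes>\<^sub>M M)) \<longlonglongrightarrow> 0"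
      using LIMSEQ_subseq_LIMSEQ[OF L2[OF t] r(1)] by (simp add: comp_def)
    ultimately have *: "AE p in ?L t \<Otimes>\<^sub>M M. ?Z t x p = ?V p"
      by (intro L2_limit_eq_AE_limit[OF W[OF t] Z'[OF t]])
    then have "AE s in ?L t. AE \<omega> in M. ?Z t x (s, \<omega>) = ?V (s, \<omega>)"
      by (rule LM.AE_pair)
    then have "AE s in lborel. s \<in> {t..T} \<longrightarrow> (AE \<omega> in M. Z t x s \<omega> = v s (X t x s \<omega>))"
      by (simp add: AE_restrict_lborel_interval)
    with M Z[OF t] feedback_pair_measurable[OF v X[OF t]] t show ?thesis
      by (intro AE_AE_eq_commute) auto
  qed
  with v show ?thesis by blast
qed

section \<open>Markovian representation of the limiting reflected system\<close>

theorem corollary3p6: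
  fixes M :: "'a measure"
    and T :: real
    and B :: "real \<Rightarrow> 'a \<Rightarrow> real^'d"
    and b :: "real \<Rightarrow> real^'d \<Rightarrow> real^'d"
    and \<sigma> :: "real \<Rightarrow> real^'d \<Rightarrow> real^'d^'d"
    and X :: "real \<Rightarrow> real^'d \<Rightarrow> real \<Rightarrow> 'a \<Rightarrow> real^'d"
    and f :: "'m::finite \<Rightarrow> real \<Rightarrow> real^'d \<Rightarrow> real^'m \<Rightarrow> real^'d^'m \<Rightarrow> real"
    and g :: "'m \<Rightarrow> 'm \<Rightarrow> real \<Rightarrow> real^'d \<Rightarrow> real"
    and h :: "'m \<Rightarrow> real^'d \<Rightarrow> real"
    and Yn :: "nat \<Rightarrow> real \<Rightarrow> real^'d \<Rightarrow> 'm \<Rightarrow> real \<Rightarrow> 'a \<Rightarrow> real"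
    and Zn :: "nat \<Rightarrow> real \<Rightarrow> real^'d \<Rightarrow> 'm \<Rightarrow> real \<Rightarrow> 'a \<Rightarrow> real^'d"
    and un :: "nat \<Rightarrow> 'm \<Rightarrow> real \<Rightarrow> real^'d \<Rightarrow> real"
    and vn :: "nat \<Rightarrow> 'm \<Rightarrow> real \<Rightarrow> real^'d \<Rightarrow> real^'d"
    and nn :: "nat \<Rightarrow> nat"
    and Y :: "real \<Rightarrow> real^'d \<Rightarrow> 'm \<Rightarrow> real \<Rightarrow> 'a \<Rightarrow> real"
    and Z :: "real \<Rightarrow> real^'d \<Rightarrow> 'm \<Rightarrow> real \<Rightarrow> 'a \<Rightarrow> real^'d"
    and K :: "real \<Rightarrow> real^'d \<Rightarrow> 'm \<Rightarrow> real \<Rightarrow> 'a \<Rightarrow> real"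
  assumes "prob_space M"
    and "T > 0"
    and "brownian_motion M T B"
    and "forward_coefficients T b \<sigma>"
    and "\<And>t x. t \<in> {0..T} \<Longrightarrow> sde_solution M B T b \<sigma> t x (X t x)"
    and "L2_domination M T X"
    and "driver_data T f"
    and "switching_costs T b \<sigma> g"
    and "terminal_data T g h"
    and "\<And>n t x. n \<ge> 1 \<Longrightarrow> t \<in> {0..T} \<Longrightarrow>
           penalized_solution M B T f g h n t (X t x) (Yn n t x) (Zn n t x)"
    and "\<And>n. n \<ge> 1 \<Longrightarrow> markov_representation M T X (Yn n) (Zn n) (un n) (vn n)"
    and "\<And>j. nn j \<ge> 1"
    and "filterlim nn at_top sequentially"
    and "\<And>i t x. t \<in> {0..T} \<Longrightarrow> convergent (\<lambda>j. un (nn j) i t x)"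
    and "\<And>i. (\<lambda>(t, x). lim (\<lambda>j. un (nn j) i t x))
           \<in> borel_measurable (restrict_space borel ({0..T} \<times> UNIV))"
    and "\<exists>C>0. \<exists>\<rho>\<ge>1. \<forall>i j. \<forall>t\<in>{0..T}. \<forall>x. \<bar>un (nn j) i t x\<bar> \<le> C * (1 + norm x powr \<rho>)"
    and "\<And>t x. t \<in> {0..T} \<Longrightarrow>
           reflected_solution M B T f g h t (X t x) (Y t x) (Z t x) (K t x)"
    and "\<And>i t x. t \<in> {0..T} \<Longrightarrow>
           (\<lambda>j. \<integral>\<^sup>+\<omega>.
               (SUP s\<in>{t..T}. ennreal (\<bar>Yn (nn j) t x i s \<omega> - Y t x i s \<omega>\<bar>\<^sup>2)) +
               (\<integral>\<^sup>+s\<in>{t..T}. ennreal ((norm (Zn (nn j) t x i s \<omega> - Z t x i s \<omega>))\<^sup>2) \<partial>lborel) +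
               (SUP s\<in>{t..T}. ennreal
                  (\<bar>penalized_K g (nn j) t (X t x) (Yn (nn j) t x) i s \<omega> - K t x i s \<omega>\<bar>\<^sup>2)) \<partial>M)
             \<longlonglongrightarrow> 0"
  shows "\<exists>(u :: 'm \<Rightarrow> real \<Rightarrow> real^'d \<Rightarrow> real) (v :: 'm \<Rightarrow> real \<Rightarrow> real^'d \<Rightarrow> real^'d).
           (\<forall>i. (\<lambda>(t, x). u i t x) \<in> borel_measurable (restrict_space borel ({0..T} \<times> UNIV)) \<and>
                (\<lambda>(t, x). v i t x) \<in> borel_measurable (restrict_space borel ({0..T} \<times> UNIV))) \<and>
           (\<forall>t\<in>{0..T}. \<forall>x i.
              AE \<omega> in M. AE s in lborel. s \<in> {t..T} \<longrightarrow>
                Y t x i s \<omega> = u i s (X t x s \<omega>) \<and> Z t x i s \<omega> = v i s (X t x s \<omega>))"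
proof -
  note M = assms(1) and T = assms(2) and B = assms(3) and lim = assms(18)
  let ?R = "restrict_space (borel :: (real \<times> (real^'d)) measure) ({0..T} \<times> UNIV)"
  let ?L = "\<lambda>t. restrict_space lborel {t..T}"
  note joint = progressive_imp_pair_measurable[OF B]
  have X: "(\<lambda>(s, \<omega>). X t x s \<omega>) \<in> borel_measurable (?L t \<Otimes>\<^sub>M M)" if "t \<in> {0..T}" for t x
    using assms(5)[OF that, of x] that by (intro joint) (auto simp: sde_solution_def)
  have Y: "(\<lambda>(s, \<omega>). Y t x i s \<omega>) \<in> borel_measurable (?L t \<Otimes>\<^sub>M M)"
    and Z: "(\<lambda>(s, \<omega>). Z t x i s \<omega>) \<in> borel_measurable (?L t \<Otimes>\<^sub>M M)" if "t \<in> {0..T}" for t x i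
    using assms(17)[OF that, of x] that
    by (auto simp: reflected_solution_def space_S2_def space_H2_def intro!: joint)
  note rep = assms(11)[OF assms(12), unfolded markov_representation_def]
  define u where "u i t x = lim (\<lambda>j. un (nn j) i t x)" for i t x
  have u: "(\<lambda>(t, x). u i t x) \<in> borel_measurable ?R" for i
    using assms(15) by (simp add: u_def)
  have Yu: "AE \<omega> in M. AE s in lborel. s \<in> {t..T} \<longrightarrow> Y t x i s \<omega> = u i s (X t x s \<omega>)"
    if t: "t \<in> {0..T}" for t x i
  proof -
    \<comment> \<open>Here the time \<open>s\<close> is fixed and arbitrary: the penalized
      \<open>Y\<close> is represented at every time and converges uniformly in time, so the whole
      sequence can be used and no subsequence enters \<open>u\<close>.\<close>
    have "AE \<omega> in M. Y t x i s \<omega> = u i s (X t x s \<omega>)" if s: "s \<in> {t..T}" for s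
    proof (rule L2_limit_eq_AE_limit)
      show "(\<lambda>\<omega>. un (nn j) i s (X t x s \<omega>)) \<in> borel_measurable M" for j
        using section_measurable[OF feedback_pair_measurable[OF conjunct1[OF spec[OF conjunct1[OF rep[of j]], of i]]
          X[OF t, of x]] s] t by simp
      show "Y t x i s \<in> borel_measurable M"
        by (rule section_measurable[OF Y[OF t] s])
      show "AE \<omega> in M. (\<lambda>j. un (nn j) i s (X t x s \<omega>)) \<longlonglongrightarrow> u i s (X t x s \<omega>)"
        using assms(14)[of s i] s t by (auto simp: u_def convergent_LIMSEQ_iff)
      show "(\<lambda>j. \<integral>\<^sup>+\<omega>. ennreal ((norm (un (nn j) i s (X t x s \<omega>) - Y t x i s \<omega>))\<^sup>2) \<partial>M) \<longlonglongrightarrow> 0"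
      proof (rule tendsto_sandwich[OF _ _ tendsto_const lim[OF t, of x i]]; intro always_eventually allI)
        fix j
        have "AE \<omega> in M. Yn (nn j) t x i s \<omega> = un (nn j) i s (X t x s \<omega>)"
          using rep[of j] t s by blast
        then show "(\<integral>\<^sup>+\<omega>. ennreal ((norm (un (nn j) i s (X t x s \<omega>) - Y t x i s \<omega>))\<^sup>2) \<partial>M) \<le>
          (\<integral>\<^sup>+\<omega>.
               (SUP s\<in>{t..T}. ennreal (\<bar>Yn (nn j) t x i s \<omega> - Y t x i s \<omega>\<bar>\<^sup>2)) +
               (\<integral>\<^sup>+s\<in>{t..T}. ennreal ((norm (Zn (nn j) t x i s \<omega> - Z t x i s \<omega>))\<^sup>2) \<partial>lborel) +
               (SUP s\<in>{t..T}. ennreal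
                  (\<bar>penalized_K g (nn j) t (X t x) (Yn (nn j) t x) i s \<omega> - K t x i s \<omega>\<bar>\<^sup>2)) \<partial>M)"
        \<comment> \<open>The value at \<open>s\<close> is at most the supremum, and the other two
          terms are nonnegative. Comparing the integrands avoids splitting the integral of the sum,
          which would require measurability of the suprema.\<close>
        proof (intro nn_integral_mono_AE, eventually_elim)
          case (elim \<omega>)
          have "ennreal (\<bar>Yn (nn j) t x i s \<omega> - Y t x i s \<omega>\<bar>\<^sup>2)
              \<le> (SUP s\<in>{t..T}. ennreal (\<bar>Yn (nn j) t x i s \<omega> - Y t x i s \<omega>\<bar>\<^sup>2))"
            using s by (rule SUP_upper)
          with elim show ?case
            by (auto intro!: add_increasing2)
        qed
      qed simp
    qed
    then have "AE s in lborel. s \<in> {t..T} \<longrightarrow> (AE \<omega> in M. Y t x i s \<omega> = u i s (X t x s \<omega>))"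
      by simp
    with M Y[OF t] feedback_pair_measurable[OF u X[OF t]] t show ?thesis
      by (intro AE_AE_eq_commute) auto
  qed
  \<comment> \<open>For fixed \<open>i\<close>, the L2 bound on \<open>Z\<close> is the middle term
    of the assumed convergence.\<close>
  have "\<exists>v. (\<lambda>(s, y). v s y) \<in> borel_measurable ?R \<and>
    (\<forall>t\<in>{0..T}. \<forall>x. AE \<omega> in M. AE s in lborel. s \<in> {t..T} \<longrightarrow> Z t x i s \<omega> = v s (X t x s \<omega>))" for i
  proof (rule common_feedback_limit[OF M _ assms(6) X, where w = "\<lambda>j. vn (nn j) i"])
    show "0 \<le> T" using T by simp
    show "(\<lambda>(s, \<omega>). Z t x i s \<omega>) \<in> borel_measurable (?L t \<Otimes>\<^sub>M M)" if "t \<in> {0..T}" for t x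
      by (rule Z[OF that])
    show "(\<lambda>(s, y). vn (nn j) i s y) \<in> borel_measurable ?R" for j
      using rep[of j] by blast
    show "(\<lambda>j. \<integral>\<^sup>+\<omega>. (\<integral>\<^sup>+s\<in>{t..T}.
        ennreal ((norm (vn (nn j) i s (X t x s \<omega>) - Z t x i s \<omega>))\<^sup>2) \<partial>lborel) \<partial>M) \<longlonglongrightarrow> 0"
      if t: "t \<in> {0..T}" for t x
    proof (rule tendsto_sandwich[OF _ _ tendsto_const lim[OF t, of x i]]; intro always_eventually allI)
      fix j
      have "AE \<omega> in M. AE s in lborel. s \<in> {t..T} \<longrightarrow> Zn (nn j) t x i s \<omega> = vn (nn j) i s (X t x s \<omega>)"
        using rep[of j] t by blast
      then show "(\<integral>\<^sup>+\<omega>. (\<integral>\<^sup>+s\<in>{t..T}.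
        ennreal ((norm (vn (nn j) i s (X t x s \<omega>) - Z t x i s \<omega>))\<^sup>2) \<partial>lborel) \<partial>M) \<le>
          (\<integral>\<^sup>+\<omega>.
               (SUP s\<in>{t..T}. ennreal (\<bar>Yn (nn j) t x i s \<omega> - Y t x i s \<omega>\<bar>\<^sup>2)) +
               (\<integral>\<^sup>+s\<in>{t..T}. ennreal ((norm (Zn (nn j) t x i s \<omega> - Z t x i s \<omega>))\<^sup>2) \<partial>lborel) +
               (SUP s\<in>{t..T}. ennreal
                  (\<bar>penalized_K g (nn j) t (X t x) (Yn (nn j) t x) i s \<omega> - K t x i s \<omega>\<bar>\<^sup>2)) \<partial>M)"
      proof (intro nn_integral_mono_AE, eventually_elim)
        case (elim \<omega>)
        \<comment> \<open>For a scenario in which the representation of \<open>Zn\<close> holds at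
          almost every time, the two time integrals are equal.\<close>
        then have "(\<integral>\<^sup>+s\<in>{t..T}.
            ennreal ((norm (vn (nn j) i s (X t x s \<omega>) - Z t x i s \<omega>))\<^sup>2) \<partial>lborel)
          = (\<integral>\<^sup>+s\<in>{t..T}. ennreal ((norm (Zn (nn j) t x i s \<omega> - Z t x i s \<omega>))\<^sup>2) \<partial>lborel)"
          by (intro nn_integral_cong_AE) (auto elim!: eventually_mono simp: indicator_def)
        then show ?case
          by (auto intro!: add_increasing2 add_increasing)
      qed
    qed simp
  qed
  then have "\<exists>v. \<forall>i. (\<lambda>(s, y). v i s y) \<in> borel_measurable ?R \<and>
    (\<forall>t\<in>{0..T}. \<forall>x. AE \<omega> in M. AE s in lborel. s \<in> {t..T} \<longrightarrow> Z t x i s \<omega> = v i s (X t x s \<omega>))"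
    by (intro choice allI)
  then obtain v where v: "\<forall>i. (\<lambda>(s, y). v i s y) \<in> borel_measurable ?R \<and>
    (\<forall>t\<in>{0..T}. \<forall>x. AE \<omega> in M. AE s in lborel. s \<in> {t..T} \<longrightarrow> Z t x i s \<omega> = v i s (X t x s \<omega>))" ..
  have "AE \<omega> in M. AE s in lborel. s \<in> {t..T} \<longrightarrow>
      Y t x i s \<omega> = u i s (X t x s \<omega>) \<and> Z t x i s \<omega> = v i s (X t x s \<omega>)"
    if "t \<in> {0..T}" for t x i
  proof -
    have "AE \<omega> in M. AE s in lborel. s \<in> {t..T} \<longrightarrow> Z t x i s \<omega> = v i s (X t x s \<omega>)"
      using v that by blast
    with Yu[OF that, of x i] show ?thesis
    proof eventually_elim
      case (elim \<omega>)
      from elim(2,1) show ?case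
        by eventually_elim simp
    qed
  qed
  with u v show ?thesis
    by blast
qed

end
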